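(* Let $L:\mathbb{R}^n\times\mathbb{R}^m\to\mathbb{R}$ be twice differentiable and $\rho$-weakly convex-weakly concave, let $\eta>0$ with $\eta>\rho$, and suppose $L$ is $\alpha$-interaction dominant (with respect to $\eta$) in both $x$ and $y$ for some $\alpha\in\mathbb{R}$. Then for every $z\in\mathbb{R}^n\times\mathbb{R}^m$, the point $z_+=\mathrm{prox}_\eta(z)$ satisfies $$\mathcal{L}(z_+)\le\mathcal{L}(z)-\frac12\left(\alpha+(\eta^{-1}-\rho^{-1})^{-1}\right)\|z_+-z\|^2 .$$
   Context: A twice differentiable $L$ is $\rho$-weakly convex-weakly concave ($\rho\in\mathbb{R}$) if $\nabla^2_{xx}L(z)\succeq-\rho I$ and $-\nabla^2_{yy}L(z)\succeq-\rho I$ for all $z=(x,y)$. For $\eta>\rho$, $L$ is $\alpha$-interaction dominant in $x$ if for all $z$ $$\nabla^2_{xx}L(z)+\nabla^2_{xy}L(z)(\eta I-\nabla^2_{yy}L(z))^{-1}\nabla^2_{yx}L(z)\succeq\alpha I,$$ and in $y$ if for all $z$ $$-\nabla^2_{yy}L(z)+\nabla^2_{yx}L(z)(\eta I+\nabla^2_{xx}L(z))^{-1}\nabla^2_{xy}L(z)\succeq\alpha I.$$ The Moreau envelope of $f$ with parameter $\eta$ is $e_\eta\{f\}(x)=\min_u f(u)+\frac{\eta}{2}\|u-x\|^2$. Define $$\mathcal{L}(x,y)=-e_\eta\{-L(x,\cdot)\}(y)-e_\eta\{L(\cdot,y)\}(x).$$ The proximal operator is $\mathrm{prox}_\eta(x,y)=\arg\min_{u\in\mathbb{R}^n}\max_{v\in\mathbb{R}^m}L(u,v)+\frac{\eta}{2}\|u-x\|^2-\frac{\eta}{2}\|v-y\|^2$,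 meaning the unique minimax (saddle) point of this strongly convex-strongly concave problem. Convention: $(\eta^{-1}-\rho^{-1})^{-1}$ is read as $-\eta\rho/(\eta-\rho)$, so it equals $0$ if $\rho=0$. *)

theory Defs
  imports "HOL-Analysis.Analysis"
begin

definition grad :: "('a::real_inner \<Rightarrow> real) \<Rightarrow> 'a \<Rightarrow> 'a" where
  "grad f z = (THE D. GDERIV f z :> D)"

lemma GDERIV_grad:
  fixes f :: "'a::euclidean_space \<Rightarrow> real"
  assumes "f differentiable (at z)"
  shows "GDERIV f z :> grad f z"
proof -
  obtain f' where f': "(f has_derivative f') (at z)"
    using assms by (auto simp: differentiable_def)
  define D where "D = (\<Sum>b\<in>Basis. f' b *\<^sub>R b)"
  have lin: "linear f'"
    using f' by (rule has_derivative_linear)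
  have "f' h = inner h D" for h
  proof -
    have "f' h = f' (\<Sum>b\<in>Basis. inner h b *\<^sub>R b)"
      by (simp add: euclidean_representation)
    also have "\<dots> = (\<Sum>b\<in>Basis. inner h b * f' b)"
      by (simp add: linear_sum[OF lin] linear_scale[OF lin])
    also have "\<dots> = inner h D"
      by (simp add: D_def inner_sum_right mult.commute)
    finally show ?thesis .
  qed
  then have "f' = (\<lambda>h. inner h D)" by (rule ext)
  with f' have D: "GDERIV f z :> D"
    by (simp add: gderiv_def)
  have "E = D" if "GDERIV f z :> E" for E
  proof -
    have "(\<lambda>h. inner h E) = (\<lambda>h. inner h D)"
      using that D unfolding gderiv_def by (rule has_derivative_unique)
    then have "inner (E - D) E = inner (E - D) D" by (rule fun_cong)
    then have "inner (E - D) (E - D) = 0" by (simp add: inner_diff_right)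
    then show ?thesis by simp
  qed
  with D have "grad f z = D"
    unfolding grad_def by (rule the_equality)
  with D show ?thesis by simp
qed

definition twice_differentiable :: "('a::real_inner \<Rightarrow> real) \<Rightarrow> bool" where
  "twice_differentiable f \<longleftrightarrow>
     (\<forall>z. f differentiable (at z)) \<and> (\<forall>z. grad f differentiable (at z))"

definition hessian :: "('a::real_inner \<Rightarrow> real) \<Rightarrow> 'a \<Rightarrow> 'a \<Rightarrow> 'a" where
  "hessian f z = frechet_derivative (grad f) (at z)"

(* The blocks are named by (row, column): hess_xy is n x m and hess_yx is m x n. *)

definition hess_xx :: "((real^'n) \<times> (real^'m) \<Rightarrow> real) \<Rightarrow> (real^'n) \<times> (real^'m) \<Rightarrow> real^'n^'n" where
  "hess_xx L z = matrix (\<lambda>h. fst (hessian L z (h, 0)))"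

definition hess_xy :: "((real^'n) \<times> (real^'m) \<Rightarrow> real) \<Rightarrow> (real^'n) \<times> (real^'m) \<Rightarrow> real^'m^'n" where
  "hess_xy L z = matrix (\<lambda>k. fst (hessian L z (0, k)))"

definition hess_yx :: "((real^'n) \<times> (real^'m) \<Rightarrow> real) \<Rightarrow> (real^'n) \<times> (real^'m) \<Rightarrow> real^'n^'m" where
  "hess_yx L z = matrix (\<lambda>h. snd (hessian L z (h, 0)))"

definition hess_yy :: "((real^'n) \<times> (real^'m) \<Rightarrow> real) \<Rightarrow> (real^'n) \<times> (real^'m) \<Rightarrow> real^'m^'m" where
  "hess_yy L z = matrix (\<lambda>k. snd (hessian L z (0, k)))"

(* Loewner order. Symmetry of A and B is not part of the definition; below, the matrices being
   compared are built from Hessian blocks of a twice differentiable function, hence symmetric. *)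
definition loewner_ge :: "real^'k^'k \<Rightarrow> real^'k^'k \<Rightarrow> bool" (infix \<open>\<succeq>\<close> 50) where
  "A \<succeq> B \<longleftrightarrow> (\<forall>v. 0 \<le> v \<bullet> ((A - B) *v v))"

definition weakly_convex_weakly_concave ::
    "real \<Rightarrow> ((real^'n) \<times> (real^'m) \<Rightarrow> real) \<Rightarrow> bool" where
  "weakly_convex_weakly_concave \<rho> L \<longleftrightarrow>
     (\<forall>z. hess_xx L z \<succeq> mat (- \<rho>) \<and> - hess_yy L z \<succeq> mat (- \<rho>))"

(* The inverses below exist when L is \<rho>-weakly convex-weakly concave with \<rho> < \<eta>. *)

definition interaction_dominant_x ::
    "real \<Rightarrow> real \<Rightarrow> ((real^'n) \<times> (real^'m) \<Rightarrow> real) \<Rightarrow> bool" where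
  "interaction_dominant_x \<eta> \<alpha> L \<longleftrightarrow>
     (\<forall>z. hess_xx L z + hess_xy L z ** matrix_inv (mat \<eta> - hess_yy L z) ** hess_yx L z
            \<succeq> mat \<alpha>)"

definition interaction_dominant_y ::
    "real \<Rightarrow> real \<Rightarrow> ((real^'n) \<times> (real^'m) \<Rightarrow> real) \<Rightarrow> bool" where
  "interaction_dominant_y \<eta> \<alpha> L \<longleftrightarrow>
     (\<forall>z. - hess_yy L z + hess_yx L z ** matrix_inv (mat \<eta> + hess_xx L z) ** hess_xy L z
            \<succeq> mat \<alpha>)"

(* Stated with the real infimum; whenever the minimum is attained, this is the minimum. *)
definition moreau_envelope :: "real \<Rightarrow> ('a::real_normed_vector \<Rightarrow> real) \<Rightarrow> 'a \<Rightarrow> real" where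
  "moreau_envelope \<eta> f x = (INF u. f u + \<eta> / 2 * (norm (u - x))\<^sup>2)"

lemma moreau_envelope_eq_min:
  assumes "is_arg_min (\<lambda>u. f u + \<eta> / 2 * (norm (u - x))\<^sup>2) (\<lambda>_. True) p"
  shows "moreau_envelope \<eta> f x = f p + \<eta> / 2 * (norm (p - x))\<^sup>2"
  unfolding moreau_envelope_def
  by (rule cInf_eq_minimum) (use assms in \<open>auto simp: is_arg_min_linorder\<close>)

definition saddle_envelope ::
    "real \<Rightarrow> ((real^'n) \<times> (real^'m) \<Rightarrow> real) \<Rightarrow> (real^'n) \<times> (real^'m) \<Rightarrow> real" where
  "saddle_envelope \<eta> L z =
     - moreau_envelope \<eta> (\<lambda>v. - L (fst z, v)) (snd z)
     - moreau_envelope \<eta> (\<lambda>u. L (u, snd z)) (fst z)"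

definition is_saddle_point :: "('a \<times> 'b \<Rightarrow> real) \<Rightarrow> 'a \<times> 'b \<Rightarrow> bool" where
  "is_saddle_point F w \<longleftrightarrow>
     (\<forall>u v. F (fst w, v) \<le> F w \<and> F w \<le> F (u, snd w))"

definition prox ::
    "real \<Rightarrow> ((real^'n) \<times> (real^'m) \<Rightarrow> real) \<Rightarrow> (real^'n) \<times> (real^'m) \<Rightarrow> (real^'n) \<times> (real^'m)" where
  "prox \<eta> L z =
     (THE w. is_saddle_point
        (\<lambda>(u, v). L (u, v) + \<eta> / 2 * (norm (u - fst z))\<^sup>2 - \<eta> / 2 * (norm (v - snd z))\<^sup>2) w)"

(* (\<eta>^{-1} - \<rho>^{-1})^{-1}, extended by 0 to \<rho> = 0. *)
definition inv_diff_inv :: "real \<Rightarrow> real \<Rightarrow> real" where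
  "inv_diff_inv \<eta> \<rho> = - (\<eta> * \<rho>) / (\<eta> - \<rho>)"

lemma inv_diff_inv_eq:
  assumes "\<eta> \<noteq> 0" "\<rho> \<noteq> 0" "\<eta> \<noteq> \<rho>"
  shows "inv_diff_inv \<eta> \<rho> = inverse (inverse \<eta> - inverse \<rho>)"
proof -
  have "inverse \<eta> - inverse \<rho> = - ((\<eta> - \<rho>) / (\<eta> * \<rho>))"
    using assms by (simp add: inverse_eq_divide diff_divide_distrib)
  then show ?thesis
    by (simp add: inv_diff_inv_def)
qed

end

theory Submission
  imports Defs
begin

text \<open>Let \<open>z = (x, y)\<close> and \<open>F(u, v) = L(u, v) + \<eta>/2 |u - x|\<^sup>2 - \<eta>/2 |v - y|\<^sup>2\<close>, whose saddle point is \<open>z\<^sub>+\<close>. The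
  function \<open>u \<mapsto> max\<^sub>v F(u, v)\<close> is minimised at the first component of \<open>z\<^sub>+\<close>, and interaction
  dominance says that it has curvature at least \<open>\<alpha> + \<eta>\<close>. Evaluating at \<open>x\<close>, and adding the
  symmetric estimate in \<open>y\<close>, shows that the envelope at \<open>z\<close> is at least
  \<open>(\<alpha> + \<eta>)/2 |z\<^sub>+ - z|\<^sup>2\<close>. On the other hand, \<open>F\<close> is \<open>(\<eta> - \<rho>)\<close>-strongly convex-concave around
  \<open>z\<^sub>+\<close>, so the envelope at \<open>z\<^sub>+\<close> is at most \<open>\<eta>\<^sup>2/(2(\<eta> - \<rho>)) |z\<^sub>+ - z|\<^sup>2\<close>. The two constants differ
  by the one in the theorem.\<close>

section \<open>Strong convexity and attained minima from second derivative bounds\<close>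

text \<open>Along the segment from x to y the function \<open>q\<close> has nonnegative derivative.
  Comparing its endpoint values needs no integration, so \<open>D\<close> may be
  discontinuous.\<close>

lemma strongly_monotone_gradient:
  fixes g :: "'a::real_inner \<Rightarrow> 'a"
  assumes g: "\<And>x. (g has_derivative D x) (at x)"
    and D: "\<And>x h. c * (norm h)\<^sup>2 \<le> h \<bullet> D x h"
  shows "c * (norm (y - x))\<^sup>2 \<le> (y - x) \<bullet> (g y - g x)"
proof -
  define d where "d = y - x"
  define q where "q t = d \<bullet> g (x + t *\<^sub>R d) - c * t * (norm d)\<^sup>2" for t
  have q': "(q has_real_derivative (d \<bullet> D (x + t *\<^sub>R d) d - c * (norm d)\<^sup>2)) (at t)" for t
  proof -
    have "((\<lambda>t. x + t *\<^sub>R d) has_derivative (\<lambda>s. s *\<^sub>R d)) (at t)"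
      by (auto intro!: derivative_eq_intros)
    from has_derivative_compose[OF this g]
    have "((\<lambda>t. g (x + t *\<^sub>R d)) has_derivative (\<lambda>s. D (x + t *\<^sub>R d) (s *\<^sub>R d))) (at t)" .
    moreover have "D (x + t *\<^sub>R d) (s *\<^sub>R d) = s *\<^sub>R D (x + t *\<^sub>R d) d" for s
      using has_derivative_linear[OF g] by (simp add: linear_scale)
    ultimately show ?thesis
      unfolding q_def has_field_derivative_def
      by (auto intro!: derivative_eq_intros simp: algebra_simps)
  qed
  have "0 \<le> d \<bullet> D (x + t *\<^sub>R d) d - c * (norm d)\<^sup>2" for t
    using D by simp
  then have "q 0 \<le> q 1"
    using q' by (intro DERIV_nonneg_imp_nondecreasing[OF zero_le_one]) blast
  then show ?thesis
    by (simp add: q_def d_def inner_diff_right)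
qed

lemma strongly_convex_lower_bound:
  fixes f :: "'a::real_inner \<Rightarrow> real"
  assumes f: "\<And>x. GDERIV f x :> g x"
    and g: "\<And>x. (g has_derivative D x) (at x)"
    and D: "\<And>x h. c * (norm h)\<^sup>2 \<le> h \<bullet> D x h"
  shows "f x + (y - x) \<bullet> g x + c / 2 * (norm (y - x))\<^sup>2 \<le> f y"
proof -
  define d where "d = y - x"
  define q where "q t = f (x + t *\<^sub>R d) - t * (d \<bullet> g x) - c / 2 * t\<^sup>2 * (norm d)\<^sup>2" for t
  have q': "(q has_real_derivative (d \<bullet> g (x + t *\<^sub>R d) - d \<bullet> g x - c * t * (norm d)\<^sup>2)) (at t)"
    for t
  proof -
    have "((\<lambda>t. x + t *\<^sub>R d) has_derivative (\<lambda>s. s *\<^sub>R d)) (at t)"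
      by (auto intro!: derivative_eq_intros)
    from has_derivative_compose[OF this f[unfolded gderiv_def]]
    have "((\<lambda>t. f (x + t *\<^sub>R d)) has_derivative (\<lambda>s. (s *\<^sub>R d) \<bullet> g (x + t *\<^sub>R d))) (at t)" .
    then show ?thesis
      unfolding q_def has_field_derivative_def
      by (auto intro!: derivative_eq_intros simp: algebra_simps)
  qed
  have "0 \<le> d \<bullet> g (x + t *\<^sub>R d) - d \<bullet> g x - c * t * (norm d)\<^sup>2" if "0 \<le> t" for t
  proof (cases "t = 0")
    case False
    \<comment> \<open>Strong monotonicity between x and x + t d, divided by t, is exactly the sign
      of the derivative of \<open>q\<close> at t.\<close>
    have "c * (norm (t *\<^sub>R d))\<^sup>2 \<le> (t *\<^sub>R d) \<bullet> (g (x + t *\<^sub>R d) - g x)"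
      using strongly_monotone_gradient[OF g D, of "x + t *\<^sub>R d" x] by simp
    then have "t * (c * t * (norm d)\<^sup>2) \<le> t * (d \<bullet> (g (x + t *\<^sub>R d) - g x))"
      by (simp add: power_mult_distrib power2_eq_square mult_ac)
    then show ?thesis
      using that False by (simp add: inner_diff_right)
  qed simp
  then have "q 0 \<le> q 1"
    using q' by (intro DERIV_nonneg_imp_nondecreasing[OF zero_le_one]) blast
  then show ?thesis
    by (simp add: q_def d_def inner_diff_right)
qed

lemma continuous_quadratic_growth_attains_min:
  fixes f :: "'a::euclidean_space \<Rightarrow> real"
  assumes f: "continuous_on UNIV f" and "0 < c"
    and growth: "\<And>y. f x + (y - x) \<bullet> g + c / 2 * (norm (y - x))\<^sup>2 \<le> f y"
  obtains p where "\<And>y. f p \<le> f y"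
proof -
  \<comment> \<open>At distance at least \<open>r\<close> from x the quadratic term outweighs the
    linear one, so values there are no smaller than \<open>f x\<close>, and a minimum over the ball
    is global.\<close>
  define r where "r = 2 * norm g / c"
  have r: "0 \<le> r" using \<open>0 < c\<close> by (simp add: r_def)
  obtain p where p: "\<And>y. y \<in> cball x r \<Longrightarrow> f p \<le> f y"
    using continuous_attains_inf[of "cball x r" f] continuous_on_subset[OF f subset_UNIV] r
    by (metis compact_cball centre_in_cball empty_iff)
  have "f p \<le> f y" for y
  proof (cases "y \<in> cball x r")
    case False
    define s where "s = norm (y - x)"
    have "r \<le> s" using False by (simp add: s_def dist_norm norm_minus_commute)
    then have "norm g \<le> c / 2 * s"
      using \<open>0 < c\<close> by (simp add: r_def field_simps)
    then have "s * norm g \<le> s * (c / 2 * s)"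
      by (intro mult_left_mono) (simp_all add: s_def)
    moreover have "\<bar>(y - x) \<bullet> g\<bar> \<le> s * norm g"
      unfolding s_def by (rule Cauchy_Schwarz_ineq2)
    ultimately have "f x \<le> f y"
      using growth[of y, folded s_def] by (simp add: power2_eq_square algebra_simps)
    moreover have "f p \<le> f x" using p r by simp
    ultimately show ?thesis by simp
  qed (use p in auto)
  then show ?thesis by (rule that)
qed

lemma GDERIV_continuous_on:
  assumes "\<And>x. GDERIV f x :> g x"
  shows "continuous_on UNIV f"
  using assms unfolding gderiv_def
  by (meson continuous_at_imp_continuous_on has_derivative_continuous)

lemma GDERIV_zero_at_min:
  assumes "GDERIV f p :> g" and "\<And>y. f p \<le> f y"
  shows "g = 0"
proof -
  have "(\<lambda>h. h \<bullet> g) = (\<lambda>h. 0)"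
    using assms(1) unfolding gderiv_def
    by (rule has_derivative_local_min) (simp add: assms(2))
  then have "g \<bullet> g = 0" by (rule fun_cong)
  then show ?thesis by simp
qed

section \<open>Strongly convex-strongly concave functions\<close>

text \<open>\<open>g\<close> and \<open>D\<close> stand for the gradient and Hessian. Only the
  diagonal blocks are bounded; the coupling between the variables is arbitrary.\<close>

locale strong_saddle =
  fixes F :: "'a::euclidean_space \<times> 'b::euclidean_space \<Rightarrow> real"
    and g :: "'a \<times> 'b \<Rightarrow> 'a \<times> 'b"
    and D :: "'a \<times> 'b \<Rightarrow> 'a \<times> 'b \<Rightarrow> 'a \<times> 'b"
    and \<mu> :: real
  assumes \<mu>_pos: "0 < \<mu>"
    and GDERIV_F: "\<And>z. GDERIV F z :> g z"
    and D: "\<And>z. (g has_derivative D z) (at z)"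
    and D_xx: "\<And>z h. \<mu> * (norm h)\<^sup>2 \<le> h \<bullet> fst (D z (h, 0))"
    and D_yy: "\<And>z k. k \<bullet> snd (D z (0, k)) \<le> - \<mu> * (norm k)\<^sup>2"
begin

lemma GDERIV_fst: "GDERIV (\<lambda>u. F (u, v)) u :> fst (g (u, v))"
proof -
  have "((\<lambda>u. (u, v)) has_derivative (\<lambda>h. (h, 0))) (at u)"
    by (auto intro!: derivative_eq_intros)
  from has_derivative_compose[OF this GDERIV_F[unfolded gderiv_def]]
  show ?thesis by (simp add: gderiv_def inner_prod_def)
qed

lemma fst_g_derivative: "((\<lambda>u. fst (g (u, v))) has_derivative (\<lambda>h. fst (D (u, v) (h, 0)))) (at u)"
proof -
  have "((\<lambda>u. (u, v)) has_derivative (\<lambda>h. (h, 0))) (at u)"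
    by (auto intro!: derivative_eq_intros)
  from has_derivative_fst[OF has_derivative_compose[OF this D]] show ?thesis .
qed

lemma lower_bound_fst:
  "F (u, v) + (u' - u) \<bullet> fst (g (u, v)) + \<mu> / 2 * (norm (u' - u))\<^sup>2 \<le> F (u', v)"
  using GDERIV_fst fst_g_derivative D_xx by (rule strongly_convex_lower_bound)

text \<open>Negating F and swapping its arguments exchanges minimisation and maximisation, so each
  fact about the first variable yields one about the second.\<close>

lemma dual: "strong_saddle (\<lambda>z. - F (prod.swap z)) (\<lambda>z. - prod.swap (g (prod.swap z)))
    (\<lambda>z w. - prod.swap (D (prod.swap z) (prod.swap w))) \<mu>"
proof
  show "0 < \<mu>" by (rule \<mu>_pos)
next
  fix z :: "'b \<times> 'a"
  have swap: "(prod.swap has_derivative prod.swap) (at z)" for z :: "'b \<times> 'a"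
    unfolding prod.swap_def by (auto intro!: derivative_eq_intros)
  have swap': "(prod.swap has_derivative prod.swap) (at z)" for z :: "'a \<times> 'b"
    unfolding prod.swap_def by (auto intro!: derivative_eq_intros)
  from has_derivative_minus[OF has_derivative_compose[OF swap GDERIV_F[unfolded gderiv_def]]]
  show "GDERIV (\<lambda>z. - F (prod.swap z)) z :> - prod.swap (g (prod.swap z))"
    by (simp add: gderiv_def inner_prod_def add.commute)
  show "((\<lambda>z. - prod.swap (g (prod.swap z))) has_derivative
      (\<lambda>w. - prod.swap (D (prod.swap z) (prod.swap w)))) (at z)"
    by (rule has_derivative_minus[OF has_derivative_compose[OF has_derivative_compose[OF swap D] swap']])
  show "\<mu> * (norm h)\<^sup>2 \<le> h \<bullet> fst (- prod.swap (D (prod.swap z) (prod.swap (h, 0))))" for h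
    using D_yy[of h "prod.swap z"] by simp
  show "k \<bullet> snd (- prod.swap (D (prod.swap z) (prod.swap (0, k)))) \<le> - \<mu> * (norm k)\<^sup>2" for k
    using D_xx[of k "prod.swap z"] by simp
qed

lemma upper_bound_snd:
  "F (u, v') \<le> F (u, v) + (v' - v) \<bullet> snd (g (u, v)) - \<mu> / 2 * (norm (v' - v))\<^sup>2"
  using strong_saddle.lower_bound_fst[OF dual, of v u v'] by simp

lemma strongly_monotone_snd:
  "\<mu> * (norm (v' - v))\<^sup>2 \<le> (v' - v) \<bullet> (snd (g (u, v)) - snd (g (u, v')))"
  using strongly_monotone_gradient[OF strong_saddle.fst_g_derivative[OF dual]
      strong_saddle.D_xx[OF dual], of v' v u] by (simp add: algebra_simps)

lemma dist_le_gradient_snd: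
  "\<mu> * norm (v' - v) \<le> norm (snd (g (u, v)) - snd (g (u, v')))"
proof (cases "v' = v")
  case False
  have "\<mu> * (norm (v' - v))\<^sup>2 \<le> norm (v' - v) * norm (snd (g (u, v)) - snd (g (u, v')))"
    using strongly_monotone_snd norm_cauchy_schwarz by (rule order_trans)
  then have "norm (v' - v) * (\<mu> * norm (v' - v))
      \<le> norm (v' - v) * norm (snd (g (u, v)) - snd (g (u, v')))"
    by (simp add: power2_eq_square mult_ac)
  then show ?thesis using False by (metis mult_le_cancel_left_pos right_minus_eq zero_less_norm_iff)
qed simp

section \<open>The best response in the second variable\<close>

lemma ex_snd_critical: "\<exists>v. snd (g (u, v)) = 0"
proof -
  interpret dual: strong_saddle "\<lambda>z. - F (prod.swap z)" "\<lambda>z. - prod.swap (g (prod.swap z))"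
    "\<lambda>z w. - prod.swap (D (prod.swap z) (prod.swap w))" \<mu>
    by (rule dual)
  have "continuous_on UNIV (\<lambda>v. - F (prod.swap (v, u)))"
    using dual.GDERIV_fst by (rule GDERIV_continuous_on)
  then obtain p where "\<And>v. - F (prod.swap (p, u)) \<le> - F (prod.swap (v, u))"
    using continuous_quadratic_growth_attains_min[OF _ \<mu>_pos dual.lower_bound_fst] by blast
  from GDERIV_zero_at_min[OF dual.GDERIV_fst this] show ?thesis by auto
qed

text \<open>This is the maximiser of F(u, .), encoded as a zero of the partial gradient. Strong
  monotonicity makes the zero unique, so the choice is determined.\<close>

definition best_response :: "'a \<Rightarrow> 'b" where
  "best_response u = (SOME v. snd (g (u, v)) = 0)"

lemma snd_g_best_response [simp]: "snd (g (u, best_response u)) = 0"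
  unfolding best_response_def by (rule someI_ex[OF ex_snd_critical])

lemma best_response_eqI: "snd (g (u, v)) = 0 \<Longrightarrow> best_response u = v"
  using dist_le_gradient_snd[of "best_response u" v u] \<mu>_pos by (simp add: mult_le_0_iff)

text \<open>Freeze the response b at u. The partial gradient at (u', b) tends to its value 0 at (u,
  b), and \<open>dist_le_gradient_snd\<close> turns it into a bound on the distance from b to the
  response at u'.\<close>

lemma isCont_best_response: "isCont best_response u"
proof -
  define b where "b = best_response u"
  have "isCont (\<lambda>u'. (u', b)) u" by (intro continuous_intros)
  moreover have "isCont g (u, b)" using D by (rule has_derivative_continuous)
  ultimately have "isCont (\<lambda>u'. g (u', b)) u" by (rule isCont_o2)
  then have "((\<lambda>u'. norm (snd (g (u', b))) / \<mu>) \<longlongrightarrow> norm (snd (g (u, b))) / \<mu>) (at u)"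
    unfolding isCont_def using \<mu>_pos by (intro tendsto_intros) auto
  then have "((\<lambda>u'. norm (snd (g (u', b))) / \<mu>) \<longlongrightarrow> 0) (at u)"
    by (simp add: b_def)
  moreover have "norm (best_response u' - b) \<le> norm (snd (g (u', b))) / \<mu>" for u'
    using dist_le_gradient_snd[of "best_response u'" b u'] \<mu>_pos by (simp add: field_simps)
  ultimately have "((\<lambda>u'. best_response u' - b) \<longlongrightarrow> 0) (at u)"
    by (metis (mono_tags, lifting) Lim_null_comparison always_eventually)
  then show ?thesis
    unfolding isCont_def b_def by (simp add: LIM_zero_iff)
qed

text \<open>The usual implicit function theorem is not applicable, since the gradient is not assumed to be
  continuously differentiable; strong monotonicity in the second variable replaces it.\<close>

lemma best_response_derivative:
  obtains A where "(best_response has_derivative A) (at u)"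
    and "\<And>h. snd (D (u, best_response u) (h, A h)) = 0"
proof -
  define b where "b = best_response u"
  define T where "T = D (u, b)"
  have T: "linear T" unfolding T_def using D by (rule has_derivative_linear)
  define M where "M k = snd (T (0, k))" for k
  define N where "N h = snd (T (h, 0))" for h
  have T_split: "snd (T (h, k)) = N h + M k" for h k
    using linear_add[OF T, of "(h, 0)" "(0, k)"] by (simp add: M_def N_def)
  have pair: "linear (\<lambda>k. (0::'a, k::'b))" "linear (\<lambda>h. (h::'a, 0::'b))" "linear (snd :: 'a \<times> 'b \<Rightarrow> 'b)"
    by (auto intro!: linearI)
  have M: "linear M" and N: "linear N"
    using linear_compose[OF linear_compose[OF pair(1) T] pair(3)]
      linear_compose[OF linear_compose[OF pair(2) T] pair(3)]
    by (auto simp: M_def[abs_def] N_def[abs_def] comp_def)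
  have M_bound: "\<mu> * norm k \<le> norm (M k)" for k
  proof (cases "k = 0")
    case False
    have "norm k * (\<mu> * norm k) \<le> k \<bullet> (- M k)"
      using D_yy[of k "(u, b)"] by (simp add: M_def T_def power2_eq_square mult_ac)
    also have "\<dots> \<le> norm k * norm (M k)"
      using norm_cauchy_schwarz[of k "- M k"] by simp
    finally show ?thesis using False by simp
  qed (simp add: linear_0[OF M])
  have "inj M"
    unfolding linear_injective_0[OF M]
  proof (intro allI impI)
    fix k assume "M k = 0"
    with M_bound[of k] \<mu>_pos show "k = 0" by (simp add: mult_le_0_iff)
  qed
  then obtain M' where M': "linear M'" "\<And>k. M (M' k) = k"
    using linear_injective_isomorphism[OF M] by blast
  \<comment> \<open>The candidate comes from formally differentiating the equation that the second
    gradient component vanishes along the response: N h + M (A h) = 0.\<close>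
  define A where "A h = - M' (N h)" for h
  have A: "linear A"
    using linear_compose_neg[OF linear_compose[OF N M'(1)]] by (simp add: A_def[abs_def] comp_def)
  have MA: "M (A h) = - N h" for h
    by (simp add: A_def linear_neg[OF M] M'(2))
  obtain K where K: "0 < K" "\<And>h. norm (A h) \<le> K * norm h"
    using linear_bounded_pos[OF A] by blast
  have "(best_response has_derivative A) (at u)"
    unfolding has_derivative_at_alt
  proof (intro conjI allI impI)
    show "bounded_linear A" using A by (rule linear_conv_bounded_linear[THEN iffD1])
  next
    fix e :: real assume "0 < e"
    \<comment> \<open>The first bound lets the left side absorb the error in \<open>norm r\<close>;
      the second leaves at most half of e \<mu> times \<open>norm h\<close>.\<close>
    define \<epsilon> where "\<epsilon> = min (\<mu> / 2) (e * \<mu> / (2 * (1 + K)))"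
    have \<epsilon>: "0 < \<epsilon>" "\<epsilon> \<le> \<mu> / 2" "\<epsilon> * (1 + K) \<le> e * \<mu> / 2"
    proof -
      show "0 < \<epsilon>" using \<mu>_pos K(1) \<open>0 < e\<close> by (simp add: \<epsilon>_def)
      show "\<epsilon> \<le> \<mu> / 2" unfolding \<epsilon>_def by (rule min.cobounded1)
      have "\<epsilon> \<le> e * \<mu> / (2 * (1 + K))" by (simp add: \<epsilon>_def)
      then show "\<epsilon> * (1 + K) \<le> e * \<mu> / 2" using K(1) by (simp add: field_simps)
    qed
    obtain \<delta> where "0 < \<delta>" and \<delta>: "\<And>z. norm (z - (u, b)) < \<delta> \<Longrightarrow>
        norm (g z - g (u, b) - T (z - (u, b))) \<le> \<epsilon> * norm (z - (u, b))"
      using D[of "(u, b)"] \<open>0 < \<epsilon>\<close> unfolding has_derivative_at_alt T_def by blast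
    obtain d where "0 < d" and d: "\<And>u'. norm (u' - u) < d \<Longrightarrow> norm (best_response u' - b) < \<delta> / 2"
      using isCont_best_response[of u, unfolded continuous_at_eps_delta, rule_format, of "\<delta> / 2"] \<open>0 < \<delta>\<close>
      by (auto simp: dist_norm b_def)
    show "\<exists>d>0. \<forall>u'. norm (u' - u) < d \<longrightarrow>
        norm (best_response u' - best_response u - A (u' - u)) \<le> e * norm (u' - u)"
    proof (intro exI conjI allI impI)
      show "0 < min d (\<delta> / 2)" using \<open>0 < d\<close> \<open>0 < \<delta>\<close> by simp
      fix u' assume u': "norm (u' - u) < min d (\<delta> / 2)"
      define h where "h = u' - u"
      define k where "k = best_response u' - b"
      define r where "r = k - A h"
      have "norm k < \<delta> / 2" using d u' by (simp add: k_def)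
      have hk: "(u', best_response u') - (u, b) = (h, k)" by (simp add: h_def k_def)
      have norm_hk: "norm (h, k) \<le> norm h + norm k" by (rule norm_Pair_le)
      then have "norm (h, k) < \<delta>" using u' \<open>norm k < \<delta> / 2\<close> by (simp add: h_def)
      have "\<mu> * norm r \<le> norm (M r)" by (rule M_bound)
      also have "M r = snd (T (h, k))"
        by (simp add: r_def linear_diff[OF M] MA T_split)
      \<comment> \<open>The second gradient component vanishes at both points, so \<open>M r\<close>
        equals, up to sign, the linearisation error of \<open>g\<close>.\<close>
      also have "norm \<dots> = norm (snd (g (u', best_response u') - g (u, b) - T (h, k)))"
        by (simp add: b_def)
      also have "\<dots> \<le> norm (g (u', best_response u') - g (u, b) - T (h, k))"
        by (metis norm_snd_le prod.collapse)
      also have "\<dots> \<le> \<epsilon> * norm (h, k)"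
        using \<delta>[of "(u', best_response u')"] \<open>norm (h, k) < \<delta>\<close> unfolding hk .
      also have "\<dots> \<le> \<epsilon> * ((1 + K) * norm h + norm r)"
      proof (rule mult_left_mono)
        have "norm k \<le> norm r + norm (A h)"
          using norm_triangle_ineq[of r "A h"] by (simp add: r_def)
        then show "norm (h, k) \<le> (1 + K) * norm h + norm r"
          using norm_hk K(2)[of h] by (simp add: algebra_simps)
      qed (use \<epsilon> in simp)
      also have "\<dots> = \<epsilon> * (1 + K) * norm h + \<epsilon> * norm r" by (simp add: algebra_simps)
      also have "\<dots> \<le> e * \<mu> / 2 * norm h + \<mu> / 2 * norm r"
        using \<epsilon> by (intro add_mono mult_right_mono) auto
      finally have "\<mu> * norm r \<le> \<mu> * (e * norm h)" by (simp add: algebra_simps)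
      then have "norm r \<le> e * norm h" using \<mu>_pos by simp
      then show "norm (best_response u' - best_response u - A (u' - u)) \<le> e * norm (u' - u)"
        by (simp add: r_def k_def h_def b_def)
    qed
  qed
  moreover have "snd (D (u, best_response u) (h, A h)) = 0" for h
    using T_split[of h "A h"] by (simp add: MA T_def b_def)
  ultimately show ?thesis by (rule that)
qed

text \<open>Envelope theorem: the derivative of the response enters only through its product with
  the second gradient component, which is zero.\<close>

lemma GDERIV_max_snd:
  "GDERIV (\<lambda>u. F (u, best_response u)) u :> fst (g (u, best_response u))"
proof -
  obtain A where A: "(best_response has_derivative A) (at u)"
    by (rule best_response_derivative)
  have "((\<lambda>u. (u, best_response u)) has_derivative (\<lambda>h. (h, A h))) (at u)"
    by (intro has_derivative_Pair has_derivative_ident A)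
  from has_derivative_compose[OF this GDERIV_F[unfolded gderiv_def]]
  show ?thesis by (simp add: gderiv_def inner_prod_def)
qed

text \<open>The maximum at u' dominates the value at the response to u, which is strongly convex in
  u'. This gives growth at the positive rate \<mu>, and so a minimiser, even if the Schur constant
  \<beta> used below is not positive.\<close>

lemma max_snd_growth:
  "F (u, best_response u) + (u' - u) \<bullet> fst (g (u, best_response u)) + \<mu> / 2 * (norm (u' - u))\<^sup>2
    \<le> F (u', best_response u')"
proof -
  have "F (u', best_response u) + \<mu> / 2 * (norm (best_response u - best_response u'))\<^sup>2
      \<le> F (u', best_response u')"
    using upper_bound_snd[of u' "best_response u" "best_response u'"] by simp
  moreover have "0 \<le> \<mu> / 2 * (norm (best_response u - best_response u'))\<^sup>2"
    using \<mu>_pos by simp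
  ultimately show ?thesis
    using lower_bound_fst[of u "best_response u" u'] by simp
qed

section \<open>Critical points and the saddle point\<close>

lemma ex_critical:
  obtains w where "g w = 0"
proof -
  have "continuous_on UNIV (\<lambda>u. F (u, best_response u))"
    using GDERIV_max_snd by (rule GDERIV_continuous_on)
  then obtain p where "\<And>u. F (p, best_response p) \<le> F (u, best_response u)"
    using continuous_quadratic_growth_attains_min[OF _ \<mu>_pos max_snd_growth] by blast
  \<comment> \<open>The first component vanishes by minimality of p, the second by the choice of
    response.\<close>
  from GDERIV_zero_at_min[OF GDERIV_max_snd this] have "g (p, best_response p) = 0"
    by (simp add: prod_eq_iff)
  then show ?thesis by (rule that)
qed

text \<open>The function being minimised in the first variable, \<open>u \<mapsto> max\<^sub>v F (u, v)\<close>, has the Schur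
  complement of the Hessian of \<open>F\<close> as its second derivative.\<close>

lemma max_snd_growth_critical:
  assumes schur: "\<And>z h k. snd (D z (h, k)) = 0 \<Longrightarrow> \<beta> * (norm h)\<^sup>2 \<le> h \<bullet> fst (D z (h, k))"
    and w: "g w = 0"
  shows "\<exists>v. F w + \<beta> / 2 * (norm (u - fst w))\<^sup>2 \<le> F (u, v)"
proof -
  have "\<forall>u. \<exists>A. (best_response has_derivative A) (at u) \<and>
      (\<forall>h. snd (D (u, best_response u) (h, A h)) = 0)"
    by (metis best_response_derivative)
  then obtain A where A: "\<And>u. (best_response has_derivative A u) (at u)"
    and A0: "\<And>u h. snd (D (u, best_response u) (h, A u h)) = 0"
    by metis
  have "((\<lambda>u. fst (g (u, best_response u))) has_derivative
      (\<lambda>h. fst (D (u, best_response u) (h, A u h)))) (at u)" for u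
    by (rule has_derivative_fst[OF has_derivative_compose[OF
          has_derivative_Pair[OF has_derivative_ident A] D]])
  \<comment> \<open>By \<open>A0\<close>, the direction (h, \<open>A u h\<close>) satisfies the
    premise of \<open>schur\<close>, which therefore bounds the second derivative of the maximum
    function.\<close>
  from strongly_convex_lower_bound[OF GDERIV_max_snd this schur[OF A0], of "fst w" u]
  show ?thesis
    using best_response_eqI[of "fst w" "snd w"] w by auto
qed

text \<open>The Moreau envelope is a real infimum; boundedness is what allows estimating it by the
  value at a single point.\<close>

lemma bdd_below_fst: "bdd_below (range (\<lambda>u. F (u, v)))"
proof -
  obtain p where "snd (- prod.swap (g (prod.swap (v, p)))) = 0"
    using strong_saddle.ex_snd_critical[OF dual, of v] by blast
  then have "F (p, v) + \<mu> / 2 * (norm (u - p))\<^sup>2 \<le> F (u, v)" for u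
    using lower_bound_fst[of p v u] by simp
  moreover have "0 \<le> \<mu> / 2 * (norm (u - p))\<^sup>2" for u using \<mu>_pos by simp
  ultimately show ?thesis
    by (intro bdd_belowI[of _ "F (p, v)"]) (smt (verit) imageE)
qed

lemma bdd_below_neg_snd: "bdd_below (range (\<lambda>v. - F (u, v)))"
  using strong_saddle.bdd_below_fst[OF dual, of u] by simp

lemma min_fst_growth_critical:
  assumes schur: "\<And>z h k. fst (D z (h, k)) = 0 \<Longrightarrow> k \<bullet> snd (D z (h, k)) \<le> - \<beta> * (norm k)\<^sup>2"
    and w: "g w = 0"
  shows "\<exists>u. F (u, v) \<le> F w - \<beta> / 2 * (norm (v - snd w))\<^sup>2"
proof -
  have "\<exists>u. - F (prod.swap (prod.swap w)) + \<beta> / 2 * (norm (v - fst (prod.swap w)))\<^sup>2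
      \<le> - F (prod.swap (v, u))"
  proof (rule strong_saddle.max_snd_growth_critical[OF dual])
    fix z h k
    assume "snd (- prod.swap (D (prod.swap z) (prod.swap (h, k)))) = 0"
    then show "\<beta> * (norm h)\<^sup>2 \<le> h \<bullet> fst (- prod.swap (D (prod.swap z) (prod.swap (h, k))))"
      using schur[of "prod.swap z" k h] by simp
  qed (simp add: w prod_eq_iff)
  then show ?thesis by (auto simp: algebra_simps)
qed

lemma critical_growth:
  assumes "g w = 0"
  shows "F w + \<mu> / 2 * (norm (u - fst w))\<^sup>2 \<le> F (u, snd w)"
    and "F (fst w, v) \<le> F w - \<mu> / 2 * (norm (v - snd w))\<^sup>2"
  using lower_bound_fst[of "fst w" "snd w" u] upper_bound_snd[of "fst w" v "snd w"] assms
  by simp_all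

lemma saddle_point_unique:
  assumes w: "g w = 0"
  shows "(THE w. is_saddle_point F w) = w"
proof (rule the_equality)
  have "0 \<le> \<mu> / 2 * (norm (u - fst w))\<^sup>2" "0 \<le> \<mu> / 2 * (norm (v - snd w))\<^sup>2" for u v
    using \<mu>_pos by simp_all
  then show "is_saddle_point F w"
    unfolding is_saddle_point_def using critical_growth[OF w] by (smt (verit))
next
  fix w' assume w': "is_saddle_point F w'"
  \<comment> \<open>The chain alternates between growth at w and the saddle inequalities of w'. It
    returns to F w, forcing both squared distances to vanish.\<close>
  have "F w + \<mu> / 2 * (norm (fst w' - fst w))\<^sup>2 \<le> F (fst w', snd w)"
    by (rule critical_growth(1)[OF w])
  also have "\<dots> \<le> F w'" using w' by (simp add: is_saddle_point_def)
  also have "\<dots> \<le> F (fst w, snd w')" using w' by (simp add: is_saddle_point_def)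
  also have "\<dots> \<le> F w - \<mu> / 2 * (norm (snd w' - snd w))\<^sup>2"
    by (rule critical_growth(2)[OF w])
  finally have "\<mu> / 2 * ((norm (fst w' - fst w))\<^sup>2 + (norm (snd w' - snd w))\<^sup>2) \<le> 0"
    by (simp add: algebra_simps)
  then have "(norm (fst w' - fst w))\<^sup>2 + (norm (snd w' - snd w))\<^sup>2 \<le> 0"
    using \<mu>_pos by (simp add: mult_le_0_iff)
  then show "w' = w"
    by (simp add: sum_power2_le_zero_iff prod_eq_iff)
qed

end

section \<open>Matrices, the Loewner order and Hessian blocks\<close>

lemma mat_vector_mult: "mat a *v v = a *\<^sub>R v" for v :: "real^'k"
proof -
  have "mat a = a *\<^sub>R (mat 1 :: real^'k^'k)"
    by (simp add: vec_eq_iff mat_def)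
  then show ?thesis
    by (simp add: scaleR_matrix_vector_assoc[symmetric])
qed

lemma uminus_matrix_vector_mult: "(- A) *v v = - (A *v v)" for A :: "real^'k^'l"
  using matrix_vector_mult_diff_rdistrib[of 0 A v] by simp

lemma loewner_ge_mat_iff: "A \<succeq> mat a \<longleftrightarrow> (\<forall>v. a * (norm v)\<^sup>2 \<le> v \<bullet> (A *v v))"
  by (simp add: loewner_ge_def matrix_vector_mult_diff_rdistrib mat_vector_mult inner_diff_right
      power2_norm_eq_inner)

text \<open>Positivity makes the kernel trivial, hence the matrix invertible. This replaces the
  inverses in interaction dominance by solutions of linear equations.\<close>

lemma matrix_inv_vector_mult_eqI:
  fixes A :: "real^'k^'k"
  assumes "0 < c" and pos: "\<And>v. c * (norm v)\<^sup>2 \<le> v \<bullet> (A *v v)"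
    and "A *v v = w"
  shows "matrix_inv A *v w = v"
proof -
  have "v = 0" if "A *v v = 0" for v
    using pos[of v] that \<open>0 < c\<close> by (simp add: mult_le_0_iff)
  then have "invertible A"
    by (simp add: invertible_left_inverse matrix_left_invertible_ker)
  then have "matrix_inv A ** A = mat 1"
    unfolding invertible_def matrix_inv_def by (rule someI2_ex) blast
  then show ?thesis
    using assms(3) by (metis matrix_vector_mul_assoc matrix_vector_mul_lid)
qed

lemma hessian_has_derivative:
  "twice_differentiable L \<Longrightarrow> (grad L has_derivative hessian L z) (at z)"
  by (simp add: twice_differentiable_def hessian_def frechet_derivative_works[symmetric])

lemma hessian_blocks:
  assumes "twice_differentiable L"
  shows "fst (hessian L z (h, k)) = hess_xx L z *v h + hess_xy L z *v k"
    and "snd (hessian L z (h, k)) = hess_yx L z *v h + hess_yy L z *v k"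
proof -
  have H: "linear (hessian L z)"
    using hessian_has_derivative[OF assms] by (rule has_derivative_linear)
  have split: "hessian L z (h, k) = hessian L z (h, 0) + hessian L z (0, k)"
    using linear_add[OF H, of "(h, 0)" "(0, k)"] by simp
  note lin = linear_add[OF H, symmetric] linear_scale[OF H, symmetric]
  have "linear (\<lambda>h. fst (hessian L z (h, 0)))" "linear (\<lambda>h. snd (hessian L z (h, 0)))"
    "linear (\<lambda>k. fst (hessian L z (0, k)))" "linear (\<lambda>k. snd (hessian L z (0, k)))"
    by (auto intro!: linearI simp: fst_add[symmetric] snd_add[symmetric] fst_scaleR[symmetric]
        snd_scaleR[symmetric] lin simp del: fst_add snd_add fst_scaleR snd_scaleR)
  then show "fst (hessian L z (h, k)) = hess_xx L z *v h + hess_xy L z *v k"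
    and "snd (hessian L z (h, k)) = hess_yx L z *v h + hess_yy L z *v k"
    by (simp_all add: split hess_xx_def hess_xy_def hess_yx_def hess_yy_def matrix_works)
qed

lemma weakly_convex_weakly_concaveD:
  assumes "weakly_convex_weakly_concave \<rho> L"
  shows "- \<rho> * (norm h)\<^sup>2 \<le> h \<bullet> (hess_xx L z *v h)"
    and "k \<bullet> (hess_yy L z *v k) \<le> \<rho> * (norm k)\<^sup>2"
proof -
  have "hess_xx L z \<succeq> mat (- \<rho>)" "- hess_yy L z \<succeq> mat (- \<rho>)"
    using assms unfolding weakly_convex_weakly_concave_def by blast+
  then show "- \<rho> * (norm h)\<^sup>2 \<le> h \<bullet> (hess_xx L z *v h)"
    and "k \<bullet> (hess_yy L z *v k) \<le> \<rho> * (norm k)\<^sup>2"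
    by (simp_all add: loewner_ge_mat_iff uminus_matrix_vector_mult)
qed

section \<open>The proximal objective and its curvature\<close>

definition prox_objective ::
    "real \<Rightarrow> ((real^'n) \<times> (real^'m) \<Rightarrow> real) \<Rightarrow> (real^'n) \<times> (real^'m) \<Rightarrow> (real^'n) \<times> (real^'m) \<Rightarrow> real" where
  "prox_objective \<eta> L z =
     (\<lambda>(u, v). L (u, v) + \<eta> / 2 * (norm (u - fst z))\<^sup>2 - \<eta> / 2 * (norm (v - snd z))\<^sup>2)"

definition prox_gradient ::
    "real \<Rightarrow> ((real^'n) \<times> (real^'m) \<Rightarrow> real) \<Rightarrow> (real^'n) \<times> (real^'m) \<Rightarrow> (real^'n) \<times> (real^'m)
      \<Rightarrow> (real^'n) \<times> (real^'m)" where
  "prox_gradient \<eta> L z w = grad L w + (\<eta> *\<^sub>R (fst w - fst z), - \<eta> *\<^sub>R (snd w - snd z))"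

definition prox_hessian ::
    "real \<Rightarrow> ((real^'n) \<times> (real^'m) \<Rightarrow> real) \<Rightarrow> (real^'n) \<times> (real^'m) \<Rightarrow> (real^'n) \<times> (real^'m)
      \<Rightarrow> (real^'n) \<times> (real^'m)" where
  "prox_hessian \<eta> L w d = hessian L w d + (\<eta> *\<^sub>R fst d, - \<eta> *\<^sub>R snd d)"

lemma prox_hessian_simps:
  assumes "twice_differentiable L"
  shows "fst (prox_hessian \<eta> L w (h, k)) = hess_xx L w *v h + hess_xy L w *v k + \<eta> *\<^sub>R h"
    and "snd (prox_hessian \<eta> L w (h, k)) = hess_yx L w *v h + hess_yy L w *v k - \<eta> *\<^sub>R k"
  by (simp_all add: prox_hessian_def hessian_blocks[OF assms])

text \<open>The penalties add \<eta> to the xx block and subtract it from the yy block, leaving the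
  coupling blocks alone, so the weak bounds improve to \<eta> - \<rho>.\<close>

lemma strong_saddle_prox_objective:
  fixes L :: "(real^'n) \<times> (real^'m) \<Rightarrow> real"
  assumes L: "twice_differentiable L" and weak: "weakly_convex_weakly_concave \<rho> L" and "\<rho> < \<eta>"
  shows "strong_saddle (prox_objective \<eta> L z) (prox_gradient \<eta> L z) (prox_hessian \<eta> L) (\<eta> - \<rho>)"
proof
  show "0 < \<eta> - \<rho>" using \<open>\<rho> < \<eta>\<close> by simp
next
  fix w :: "(real^'n) \<times> (real^'m)"
  have "GDERIV L w :> grad L w"
    using L unfolding twice_differentiable_def by (intro GDERIV_grad) blast
  then show "GDERIV (prox_objective \<eta> L z) w :> prox_gradient \<eta> L z w"
    unfolding gderiv_def prox_objective_def prox_gradient_def case_prod_unfold power2_norm_eq_inner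
    by (auto intro!: derivative_eq_intros simp: inner_prod_def inner_commute algebra_simps)
  show "(prox_gradient \<eta> L z has_derivative prox_hessian \<eta> L w) (at w)"
    unfolding prox_gradient_def[abs_def] prox_hessian_def[abs_def]
    by (auto intro!: derivative_eq_intros has_derivative_Pair hessian_has_derivative[OF L])
  show "(\<eta> - \<rho>) * (norm h)\<^sup>2 \<le> h \<bullet> fst (prox_hessian \<eta> L w (h, 0))" for h
    using weakly_convex_weakly_concaveD(1)[OF weak, of h w]
    by (simp add: prox_hessian_simps[OF L] inner_add_right power2_norm_eq_inner algebra_simps)
  show "k \<bullet> snd (prox_hessian \<eta> L w (0, k)) \<le> - (\<eta> - \<rho>) * (norm k)\<^sup>2" for k
    using weakly_convex_weakly_concaveD(2)[OF weak, of k w]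
    by (simp add: prox_hessian_simps[OF L] inner_diff_right power2_norm_eq_inner algebra_simps)
qed

text \<open>The premise says that k solves the linear system whose inverse appears in the dominance
  condition. Substituting k gives the quadratic form of that condition plus \<eta> from the
  penalty.\<close>

lemma interaction_dominant_x_schur:
  fixes L :: "(real^'n) \<times> (real^'m) \<Rightarrow> real"
  assumes L: "twice_differentiable L" and weak: "weakly_convex_weakly_concave \<rho> L" and "\<rho> < \<eta>"
    and dom: "interaction_dominant_x \<eta> \<alpha> L"
    and crit: "snd (prox_hessian \<eta> L w (h, k)) = 0"
  shows "(\<alpha> + \<eta>) * (norm h)\<^sup>2 \<le> h \<bullet> fst (prox_hessian \<eta> L w (h, k))"
proof -
  define M where "M = mat \<eta> - hess_yy L w"
  have "(\<eta> - \<rho>) * (norm v)\<^sup>2 \<le> v \<bullet> (M *v v)" for v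
    using weakly_convex_weakly_concaveD(2)[OF weak, of v w]
    by (simp add: M_def matrix_vector_mult_diff_rdistrib mat_vector_mult inner_diff_right
        power2_norm_eq_inner algebra_simps)
  moreover have "M *v k = hess_yx L w *v h"
    using crit by (simp add: M_def prox_hessian_simps[OF L] matrix_vector_mult_diff_rdistrib
        mat_vector_mult algebra_simps)
  ultimately have "matrix_inv M *v (hess_yx L w *v h) = k"
    using \<open>\<rho> < \<eta>\<close> by (intro matrix_inv_vector_mult_eqI[of "\<eta> - \<rho>"]) auto
  moreover have "\<alpha> * (norm h)\<^sup>2
      \<le> h \<bullet> ((hess_xx L w + hess_xy L w ** matrix_inv M ** hess_yx L w) *v h)"
    using dom unfolding interaction_dominant_x_def loewner_ge_mat_iff M_def by blast
  ultimately have "\<alpha> * (norm h)\<^sup>2 \<le> h \<bullet> (hess_xx L w *v h + hess_xy L w *v k)"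
    by (simp add: matrix_vector_mult_add_rdistrib matrix_vector_mul_assoc[symmetric])
  then show ?thesis
    by (simp add: prox_hessian_simps[OF L] inner_add_right power2_norm_eq_inner algebra_simps)
qed

lemma interaction_dominant_y_schur:
  fixes L :: "(real^'n) \<times> (real^'m) \<Rightarrow> real"
  assumes L: "twice_differentiable L" and weak: "weakly_convex_weakly_concave \<rho> L" and "\<rho> < \<eta>"
    and dom: "interaction_dominant_y \<eta> \<alpha> L"
    and crit: "fst (prox_hessian \<eta> L w (h, k)) = 0"
  shows "k \<bullet> snd (prox_hessian \<eta> L w (h, k)) \<le> - (\<alpha> + \<eta>) * (norm k)\<^sup>2"
proof -
  define M where "M = mat \<eta> + hess_xx L w"
  have "(\<eta> - \<rho>) * (norm v)\<^sup>2 \<le> v \<bullet> (M *v v)" for v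
    using weakly_convex_weakly_concaveD(1)[OF weak, of v w]
    by (simp add: M_def matrix_vector_mult_add_rdistrib mat_vector_mult inner_add_right
        power2_norm_eq_inner algebra_simps)
  \<comment> \<open>Here the critical equation reads M h + \<open>hess_xy L w *v k\<close> = 0, so
    the inverse produces -h; in x it produced +k.\<close>
  moreover have "M *v (- h) = hess_xy L w *v k"
  proof -
    have "M *v h + hess_xy L w *v k = 0"
      using crit by (simp add: M_def prox_hessian_simps[OF L] matrix_vector_mult_add_rdistrib
          mat_vector_mult algebra_simps)
    then show ?thesis
      by (simp add: vec.neg minus_unique)
  qed
  ultimately have "matrix_inv M *v (hess_xy L w *v k) = - h"
    using \<open>\<rho> < \<eta>\<close> by (intro matrix_inv_vector_mult_eqI[of "\<eta> - \<rho>"]) auto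
  moreover have "\<alpha> * (norm k)\<^sup>2
      \<le> k \<bullet> ((- hess_yy L w + hess_yx L w ** matrix_inv M ** hess_xy L w) *v k)"
    using dom unfolding interaction_dominant_y_def loewner_ge_mat_iff M_def by blast
  ultimately have "\<alpha> * (norm k)\<^sup>2 \<le> k \<bullet> (- (hess_yy L w *v k) - hess_yx L w *v h)"
    by (simp add: matrix_vector_mult_diff_rdistrib matrix_vector_mul_assoc[symmetric] vec.neg
        algebra_simps)
  then show ?thesis
    by (simp add: prox_hessian_simps[OF L] inner_add_right inner_diff_right power2_norm_eq_inner
        algebra_simps)
qed

text \<open>Recentring the quadratic penalty from \<open>y\<close> to \<open>p\<close> costs a linear term, which the strong
  convexity absorbs.\<close>

lemma recentred_growth:
  fixes p y v :: "'a::real_inner"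
  assumes "\<rho> < \<eta>"
    and growth: "c + \<eta> / 2 * (norm (p - y))\<^sup>2 + (\<eta> - \<rho>) / 2 * (norm (v - p))\<^sup>2
      \<le> f + \<eta> / 2 * (norm (v - y))\<^sup>2"
  shows "c - \<eta>\<^sup>2 / (2 * (\<eta> - \<rho>)) * (norm (p - y))\<^sup>2 \<le> f + \<eta> / 2 * (norm (v - p))\<^sup>2"
proof -
  define m where "m = \<eta> - \<rho>"
  have "0 < m" using \<open>\<rho> < \<eta>\<close> by (simp add: m_def)
  define a b where "a = v - p" and "b = p - y"
  \<comment> \<open>The weight \<eta> / m makes the cross term of the square exactly the linear
    recentring term.\<close>
  have "0 \<le> m / 2 * (norm (a - (\<eta> / m) *\<^sub>R b))\<^sup>2"
    using \<open>0 < m\<close> by simp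
  also have "\<dots> = m / 2 * (norm a)\<^sup>2 - \<eta> * (a \<bullet> b) + \<eta>\<^sup>2 / (2 * m) * (norm b)\<^sup>2"
    unfolding power2_norm_eq_inner using \<open>0 < m\<close>
    by (simp add: inner_diff_left inner_diff_right inner_commute[of b a] power2_eq_square field_simps)
  finally have "\<eta> * (a \<bullet> b) \<le> m / 2 * (norm a)\<^sup>2 + \<eta>\<^sup>2 / (2 * m) * (norm b)\<^sup>2" by simp
  moreover have "(norm (v - y))\<^sup>2 = (norm a)\<^sup>2 + 2 * (a \<bullet> b) + (norm b)\<^sup>2"
  proof -
    have "v - y = a + b" by (simp add: a_def b_def)
    then show ?thesis
      by (simp add: power2_norm_eq_inner inner_add_left inner_add_right inner_commute)
  qed
  ultimately show ?thesis
    using growth unfolding m_def[symmetric] a_def[symmetric] b_def[symmetric]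
    by (simp add: algebra_simps)
qed

theorem theorem5p2:
  fixes L :: "(real^'n) \<times> (real^'m) \<Rightarrow> real"
    and \<rho> \<eta> \<alpha> :: real
    and z :: "(real^'n) \<times> (real^'m)"
  assumes "twice_differentiable L"
    and "weakly_convex_weakly_concave \<rho> L"
    and "\<eta> > 0" and "\<eta> > \<rho>"
    and "interaction_dominant_x \<eta> \<alpha> L"
    and "interaction_dominant_y \<eta> \<alpha> L"
  shows "saddle_envelope \<eta> L (prox \<eta> L z)
           \<le> saddle_envelope \<eta> L z
              - 1 / 2 * (\<alpha> + inv_diff_inv \<eta> \<rho>) * (norm (prox \<eta> L z - z))\<^sup>2"
proof -
  define F where "F = prox_objective \<eta> L z"
  interpret strong_saddle F "prox_gradient \<eta> L z" "prox_hessian \<eta> L" "\<eta> - \<rho>"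
    unfolding F_def using assms by (intro strong_saddle_prox_objective) auto
  have F_eq: "F (u, v) = L (u, v) + \<eta> / 2 * (norm (u - fst z))\<^sup>2 - \<eta> / 2 * (norm (v - snd z))\<^sup>2"
    for u v by (simp add: F_def prox_objective_def)
  obtain w where w: "prox_gradient \<eta> L z w = 0" by (rule ex_critical)
  have prox: "prox \<eta> L z = w"
    using saddle_point_unique[OF w] by (simp add: prox_def F_def prox_objective_def)
  define p q where "p = (norm (fst w - fst z))\<^sup>2" and "q = (norm (snd w - snd z))\<^sup>2"
  define C where "C = \<eta>\<^sup>2 / (2 * (\<eta> - \<rho>))"
  have Fw: "F w = L w + \<eta> / 2 * p - \<eta> / 2 * q"
    using F_eq[of "fst w" "snd w"] by (simp add: p_def q_def)

  have "moreau_envelope \<eta> (\<lambda>v. - L (fst z, v)) (snd z) \<le> - (F w + (\<alpha> + \<eta>) / 2 * p)"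
  proof -
    obtain v where "F w + (\<alpha> + \<eta>) / 2 * (norm (fst z - fst w))\<^sup>2 \<le> F (fst z, v)"
      using max_snd_growth_critical[OF interaction_dominant_x_schur w, OF assms(1,2,4,5)] by blast
    then have "- F (fst z, v) \<le> - (F w + (\<alpha> + \<eta>) / 2 * p)"
      by (simp add: p_def norm_minus_commute)
    \<comment> \<open>At u = \<open>fst z\<close> the penalty in u vanishes, so -F is precisely the
      function under the infimum.\<close>
    moreover have "moreau_envelope \<eta> (\<lambda>v. - L (fst z, v)) (snd z) \<le> - F (fst z, v)"
      using cINF_lower[OF bdd_below_neg_snd[of "fst z"], of v]
      by (simp add: moreau_envelope_def F_eq)
    ultimately show ?thesis by simp
  qed
  moreover have "moreau_envelope \<eta> (\<lambda>u. L (u, snd z)) (fst z) \<le> F w - (\<alpha> + \<eta>) / 2 * q"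
  proof -
    obtain u where "F (u, snd z) \<le> F w - (\<alpha> + \<eta>) / 2 * (norm (snd z - snd w))\<^sup>2"
      using min_fst_growth_critical[OF interaction_dominant_y_schur w, OF assms(1,2,4,6)] by blast
    then have "F (u, snd z) \<le> F w - (\<alpha> + \<eta>) / 2 * q"
      by (simp add: q_def norm_minus_commute)
    moreover have "moreau_envelope \<eta> (\<lambda>u. L (u, snd z)) (fst z) \<le> F (u, snd z)"
      using cINF_lower[OF bdd_below_fst[of "snd z"], of u]
      by (simp add: moreau_envelope_def F_eq)
    ultimately show ?thesis by simp
  qed
  moreover have "- L w - C * q \<le> moreau_envelope \<eta> (\<lambda>v. - L (fst w, v)) (snd w)"
    unfolding moreau_envelope_def
  proof (rule cINF_greatest)
    fix v
    \<comment> \<open>The penalty in the first variable is the same on both sides of the growth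
      bound and cancels.\<close>
    have "- L w + \<eta> / 2 * q + (\<eta> - \<rho>) / 2 * (norm (v - snd w))\<^sup>2
        \<le> - L (fst w, v) + \<eta> / 2 * (norm (v - snd z))\<^sup>2"
      using critical_growth(2)[OF w, of v] Fw by (simp add: F_eq p_def)
    then show "- L w - C * q \<le> - L (fst w, v) + \<eta> / 2 * (norm (v - snd w))\<^sup>2"
      unfolding C_def q_def using \<open>\<eta> > \<rho>\<close> by (intro recentred_growth)
  qed simp
  moreover have "L w - C * p \<le> moreau_envelope \<eta> (\<lambda>u. L (u, snd w)) (fst w)"
    unfolding moreau_envelope_def
  proof (rule cINF_greatest)
    fix u
    have "L w + \<eta> / 2 * p + (\<eta> - \<rho>) / 2 * (norm (u - fst w))\<^sup>2
        \<le> L (u, snd w) + \<eta> / 2 * (norm (u - fst z))\<^sup>2"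
      using critical_growth(1)[OF w, of u] Fw by (simp add: F_eq q_def)
    then show "L w - C * p \<le> L (u, snd w) + \<eta> / 2 * (norm (u - fst w))\<^sup>2"
      unfolding C_def p_def using \<open>\<eta> > \<rho>\<close> by (intro recentred_growth)
  qed simp
  \<comment> \<open>The terms F w cancel between the two envelopes at z, and the terms L w between
    those at w.\<close>
  ultimately have "saddle_envelope \<eta> L w \<le> saddle_envelope \<eta> L z + (C - (\<alpha> + \<eta>) / 2) * (p + q)"
    by (simp add: saddle_envelope_def algebra_simps add_divide_distrib)
  moreover have "C - (\<alpha> + \<eta>) / 2 = - (1 / 2 * (\<alpha> + inv_diff_inv \<eta> \<rho>))"
    using \<open>\<eta> > \<rho>\<close> by (simp add: C_def inv_diff_inv_def field_simps power2_eq_square)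
  moreover have "p + q = (norm (w - z))\<^sup>2"
    by (simp add: p_def q_def norm_prod_def)
  ultimately show ?thesis
    by (simp add: prox)
qed

end
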